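(* Let $\mathcal{C}\subseteq\{0,1\}^n$ be a binary weakly self-dual linear code of length $n$ (that is, $\mathcal{C}\subseteq\mathcal{C}^\perp$) with weight distribution $(A_0,A_1,\ldots,A_n)$. Then for every integer $w$ with $0<w<\frac{n}{2}$, $$A_w\leq 2^{\frac{1}{2}H_2\left(\frac{w}{n}\right)n}$$ and $$A_w\leq \sqrt{e}\,(n-w+1)^{w/2}.$$
   Context: A binary linear code of length $n$ is a linear subspace $\mathcal{C}$ of $\{0,1\}^n=\mathrm{GF}(2)^n$. Its dual is $\mathcal{C}^\perp=\{\boldsymbol{a}\in\mathrm{GF}(2)^n : \sum_i a_ic_i=0 \text{ in } \mathrm{GF}(2) \text{ for all } \boldsymbol{c}\in\mathcal{C}\}$. The code $\mathcal{C}$ is weakly self-dual if $\mathcal{C}\subseteq\mathcal{C}^\perp$. The weight distribution of $\mathcal{C}$ is $(A_0,\ldots,A_n)$, where $A_w$ is the number of codewords of $\mathcal{C}$ of Hamming weight $w$. $H_2(x)=-x\log_2 x-(1-x)\log_2(1-x)$ for $0<x<1$ is the binary entropy function, and $e$ is the base of the natural logarithm. *)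

theory Defs
  imports "HOL-Analysis.Analysis" "HOL-Library.Z2"
begin

text \<open>Binary words of length $n$ are vectors of type \<open>bit ^ 'n\<close> with \<open>CARD('n) = n\<close>,
  where \<open>bit\<close> is the field GF(2); a binary linear code is a set \<open>C\<close> with \<open>vec.subspace C\<close>.\<close>

definition dual_code :: "(bit ^ 'n) set \<Rightarrow> (bit ^ 'n) set" where
  "dual_code C = {a. \<forall>c\<in>C. (\<Sum>i\<in>UNIV. a $ i * c $ i) = 0}"

definition weakly_self_dual :: "(bit ^ 'n) set \<Rightarrow> bool" where
  "weakly_self_dual C \<longleftrightarrow> C \<subseteq> dual_code C"

definition hamming_weight :: "bit ^ 'n \<Rightarrow> nat" where
  "hamming_weight c = card {i. c $ i \<noteq> 0}"

definition weight_distribution :: "(bit ^ 'n) set \<Rightarrow> nat \<Rightarrow> nat" where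
  "weight_distribution C w = card {c \<in> C. hamming_weight c = w}"

definition binary_entropy :: "real \<Rightarrow> real" where
  "binary_entropy x = - x * log 2 x - (1 - x) * log 2 (1 - x)"

end

theory Submission
  imports Defs
begin

text \<open>Choose a set \<open>S\<close> of coordinates that is minimal among those on which the code \<open>C\<close> is
  faithfully represented. If a nonzero codeword \<open>c\<close> lived inside \<open>S\<close>, then by minimality some
  codeword \<open>d\<close> would meet \<open>S\<close> in exactly one coordinate of the support of \<open>c\<close>, contradicting
  self-orthogonality; hence \<open>C\<close> is also faithfully represented on the complement of \<open>S\<close>. The
  Cauchy--Schwarz inequality along the splitting of the coordinates into \<open>S\<close> and its complement
  bounds the weight enumerator by \<open>(1 + y\<^sup>2) ^ (n/2)\<close>, and \<open>y\<^sup>2 = w / (n - w)\<close> gives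
  the entropy bound. The second bound follows from the first one.\<close>

text \<open>Over GF(2) a word is the indicator of its support, so restricting codewords to
  coordinates becomes intersecting sets.\<close>

definition supp :: "bit ^ 'n \<Rightarrow> 'n set" where
  "supp c = {i. c $ i \<noteq> 0}"

lemma inj_supp: "inj supp"
proof (rule injI)
  fix c d :: "bit ^ 'n" assume eq: "supp c = supp d"
  show "c = d"
  proof (rule vec_eq_iff[THEN iffD2], rule allI)
    fix i
    from eq have "c $ i \<noteq> 0 \<longleftrightarrow> d $ i \<noteq> 0"
      by (auto simp: supp_def)
    then show "c $ i = d $ i"
      by (cases "c $ i"; cases "d $ i") auto
  qed
qed

lemma finite_code: "finite (C :: (bit ^ 'n) set)"
  using finite_imageD[OF _ inj_on_subset[OF inj_supp subset_UNIV]] finite by blast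

lemma hamming_weight_eq_card_supp: "hamming_weight c = card (supp c)"
  by (simp add: hamming_weight_def supp_def)

lemma supp_disjoint_diff:
  assumes "supp c \<inter> S = supp d \<inter> S"
  shows "supp (c - d) \<inter> S = {}"
proof -
  have "c $ i = d $ i" if "i \<in> S" for i
  proof -
    from assms that have "c $ i \<noteq> 0 \<longleftrightarrow> d $ i \<noteq> 0"
      by (auto simp: supp_def)
    then show ?thesis
      by (cases "c $ i"; cases "d $ i") auto
  qed
  then show ?thesis
    by (auto simp: supp_def)
qed

text \<open>By linearity, two codewords agreeing on \<open>S\<close> differ by a codeword vanishing
  on \<open>S\<close>; a trivial kernel therefore gives injectivity.\<close>

lemma inj_on_supp_Int:
  assumes "vec.subspace C"
    and "\<And>c. c \<in> C \<Longrightarrow> supp c \<inter> S = {} \<Longrightarrow> c = 0"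
  shows "inj_on (\<lambda>c. supp c \<inter> S) C"
proof (rule inj_onI)
  fix c d assume "c \<in> C" "d \<in> C" "supp c \<inter> S = supp d \<inter> S"
  then have "c - d = 0"
    using assms vec.subspace_diff supp_disjoint_diff by blast
  then show "c = d" by simp
qed

text \<open>The inner product over GF(2) is the parity of the overlap of the supports, and a
  one-element overlap is odd.\<close>

lemma orthogonal_supp_Int:
  assumes "weakly_self_dual C" "c \<in> C" "d \<in> C"
  shows "supp c \<inter> supp d \<noteq> {i}"
proof
  assume single: "supp c \<inter> supp d = {i}"
  have "c $ j * d $ j = (if j = i then 1 else 0)" for j
  proof -
    have "j \<in> supp c \<inter> supp d \<longleftrightarrow> j = i"
      using single by blast
    then show ?thesis
      by (auto simp: supp_def)
  qed
  then have "(\<Sum>j\<in>UNIV. c $ j * d $ j) = 1"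
    by simp
  moreover have "(\<Sum>j\<in>UNIV. c $ j * d $ j) = 0"
    using assms by (auto simp: weakly_self_dual_def dual_code_def)
  ultimately show False by simp
qed

lemma faithful_split:
  fixes C :: "(bit ^ 'n) set"
  assumes C: "vec.subspace C" "weakly_self_dual C"
  obtains S where "inj_on (\<lambda>c. supp c \<inter> S) C" "inj_on (\<lambda>c. supp c \<inter> - S) C"
proof -
  \<comment> \<open>Faithful representation in kernel form: only the zero codeword vanishes on such
    a coordinate set.\<close>
  define F where "F = {S :: 'n set. \<forall>c\<in>C. supp c \<inter> S = {} \<longrightarrow> c = 0}"
  have "UNIV \<in> F"
    using injD[OF inj_supp] by (auto simp: F_def supp_def vec_eq_iff)
  then obtain S where S: "S \<in> F" and min: "\<And>T. T \<in> F \<Longrightarrow> T \<subseteq> S \<Longrightarrow> S = T"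
    using finite_has_minimal[of F] by auto
  have "c = 0" if c: "c \<in> C" "supp c \<inter> - S = {}" for c
  proof (rule ccontr)
    assume "c \<noteq> 0"
    then obtain i where i: "i \<in> supp c"
      by (auto simp: supp_def vec_eq_iff)
    with c have "i \<in> S" by blast
    then have "S - {i} \<notin> F"
      using min[of "S - {i}"] by blast
    then obtain d where d: "d \<in> C" "supp d \<inter> (S - {i}) = {}" "d \<noteq> 0"
      by (auto simp: F_def)
    with S have "supp d \<inter> S \<noteq> {}"
      by (auto simp: F_def)
    \<comment> \<open>The support of \<open>c\<close> lies in \<open>S\<close>, and \<open>d\<close>
      is nonzero on \<open>S\<close> at \<open>i\<close> only, so the two supports overlap exactly
      there.\<close>
    with d c i have "supp c \<inter> supp d = {i}" by blast
    with orthogonal_supp_Int[OF C(2) c(1) d(1)] show False by blast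
  qed
  then have "inj_on (\<lambda>c. supp c \<inter> - S) C"
    using inj_on_supp_Int[OF C(1)] by blast
  moreover have "inj_on (\<lambda>c. supp c \<inter> S) C"
    using inj_on_supp_Int[OF C(1)] S by (auto simp: F_def)
  ultimately show thesis using that by blast
qed

text \<open>Injectivity makes the sets \<open>f c\<close> distinct subsets of \<open>S\<close>, so
  the sum is part of the generating function of all subsets of \<open>S\<close> by size, which is a
  binomial power.\<close>

lemma sum_power_card_le:
  fixes z :: real
  assumes "0 \<le> z" "finite S" "inj_on f C" "f ` C \<subseteq> Pow S"
  shows "(\<Sum>c\<in>C. z ^ card (f c)) \<le> (1 + z) ^ card S"
proof -
  have "(\<Sum>c\<in>C. z ^ card (f c)) = (\<Sum>X\<in>f ` C. z ^ card X)"
    using assms(3) by (simp add: sum.reindex)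
  also have "\<dots> \<le> (\<Sum>X\<in>Pow S. z ^ card X)"
    using assms by (intro sum_mono2) auto
  also have "\<dots> = (1 + z) ^ card S"
    using prod_add[OF assms(2), of "\<lambda>_. z" "\<lambda>_. 1"] by (simp add: add.commute)
  finally show ?thesis .
qed

lemma weight_enumerator_le:
  fixes C :: "(bit ^ 'n) set" and y :: real
  assumes C: "vec.subspace C" "weakly_self_dual C" and "0 \<le> y"
  shows "(\<Sum>c\<in>C. y ^ hamming_weight c)\<^sup>2 \<le> (1 + y\<^sup>2) ^ CARD('n)"
proof -
  obtain S where S: "inj_on (\<lambda>c. supp c \<inter> S) C" "inj_on (\<lambda>c. supp c \<inter> - S) C"
    using faithful_split[OF C] .
  have wt: "hamming_weight c = card (supp c \<inter> S) + card (supp c \<inter> - S)" for c :: "bit ^ 'n"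
    unfolding hamming_weight_eq_card_supp
    by (subst card_Un_disjoint[symmetric]) (auto intro: arg_cong[where f = card])
  have "(\<Sum>c\<in>C. y ^ hamming_weight c)\<^sup>2
      = (\<Sum>c\<in>C. y ^ card (supp c \<inter> S) * y ^ card (supp c \<inter> - S))\<^sup>2"
    by (simp add: wt power_add)
  \<comment> \<open>Cauchy-Schwarz squares \<open>y\<close> in each factor, which is why the bound
    is in terms of \<open>1 + y\<^sup>2\<close>.\<close>
  also have "\<dots> \<le> (\<Sum>c\<in>C. (y ^ card (supp c \<inter> S))\<^sup>2) * (\<Sum>c\<in>C. (y ^ card (supp c \<inter> - S))\<^sup>2)"
    by (rule Cauchy_Schwarz_ineq_sum)
  also have "\<dots> = (\<Sum>c\<in>C. y\<^sup>2 ^ card (supp c \<inter> S)) * (\<Sum>c\<in>C. y\<^sup>2 ^ card (supp c \<inter> - S))"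
    by (simp flip: power_mult add: mult.commute)
  also have "\<dots> \<le> (1 + y\<^sup>2) ^ card S * (1 + y\<^sup>2) ^ card (- S)"
    using S by (intro mult_mono sum_power_card_le sum_nonneg) auto
  also have "\<dots> = (1 + y\<^sup>2) ^ CARD('n)"
    by (simp flip: power_add add: Compl_eq_Diff_UNIV card_Diff_subset card_mono)
  finally show ?thesis .
qed

text \<open>The words of weight \<open>w\<close> contribute one part of the enumerator at
  \<open>y = sqrt z\<close>. Squaring keeps the statement free of roots.\<close>

lemma weight_distribution_le:
  fixes C :: "(bit ^ 'n) set" and z :: real
  assumes C: "vec.subspace C" "weakly_self_dual C" and "0 \<le> z"
  shows "(real (weight_distribution C w))\<^sup>2 * z ^ w \<le> (1 + z) ^ CARD('n)"
proof -
  have "real (weight_distribution C w) * sqrt z ^ w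
      = (\<Sum>c\<in>{c \<in> C. hamming_weight c = w}. sqrt z ^ hamming_weight c)"
    by (simp add: weight_distribution_def)
  also have "\<dots> \<le> (\<Sum>c\<in>C. sqrt z ^ hamming_weight c)"
    using assms(3) by (intro sum_mono2 finite_code) auto
  finally have "(real (weight_distribution C w) * sqrt z ^ w)\<^sup>2
      \<le> (\<Sum>c\<in>C. sqrt z ^ hamming_weight c)\<^sup>2"
    using assms(3) by (intro power_mono) auto
  also have "\<dots> \<le> (1 + (sqrt z)\<^sup>2) ^ CARD('n)"
    using weight_enumerator_le[OF C, of "sqrt z"] assms(3) by simp
  finally show ?thesis
    using assms(3) by (simp add: power_mult_distrib flip: real_sqrt_power)
qed

text \<open>Removes the logarithms: the entropy power is the reciprocal of
  \<open>(w/n) ^ w * (m/n) ^ m\<close>, so both bounds reduce to inequalities between integer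
  powers.\<close>

lemma powr_binary_entropy:
  assumes "0 < w" "0 < m" and n: "n = w + m"
  shows "2 powr (binary_entropy (real w / real n) * real n)
    = real n ^ n / (real w ^ w * real m ^ m)"
proof -
  have "1 - real w / real n = real m / real n"
    using assms by (simp add: field_simps)
  moreover have "log 2 (real k / real n) = - log 2 (real n / real k)" if "0 < k" for k
    using assms that by (simp add: log_divide)
  ultimately have "binary_entropy (real w / real n)
      = (real w * log 2 (real n / real w) + real m * log 2 (real n / real m)) / real n"
    using assms by (simp add: binary_entropy_def add_divide_distrib)
  then have "binary_entropy (real w / real n) * real n
      = real w * log 2 (real n / real w) + real m * log 2 (real n / real m)"
    using assms by simp
  then have "2 powr (binary_entropy (real w / real n) * real n)
      = (2 powr log 2 (real n / real w)) powr real w * (2 powr log 2 (real n / real m)) powr real m"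
    by (simp add: powr_add powr_powr mult.commute)
  also have "\<dots> = (real n / real w) ^ w * (real n / real m) ^ m"
    using assms by (simp add: powr_realpow)
  also have "\<dots> = real n ^ n / (real w ^ w * real m ^ m)"
    by (simp add: n power_divide power_add)
  finally show ?thesis .
qed

text \<open>The Taylor polynomial of degree 6 at 1 is about 2.71806, and the crude estimate
  \<open>exp t \<le> 3\<close> already keeps the remainder below 0.0006.\<close>

lemma exp_1_less: "exp 1 < (272 / 100 :: real)"
proof -
  obtain t :: real where t: "\<bar>t\<bar> \<le> \<bar>1\<bar>"
    and e: "exp 1 = (\<Sum>m<7. 1 ^ m / fact m) + exp t / fact 7 * 1 ^ (7::nat)"
    using Maclaurin_exp_le[of 1 7] by blast
  have "exp t \<le> exp 1" using t by simp
  then have "exp t \<le> 3" using exp_le by linarith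
  with e show ?thesis
    by (simp add: fact_numeral lessThan_nat_numeral lessThan_Suc)
qed

text \<open>For \<open>w = 2\<close>, \<open>m = 3\<close> the inequality fails: the left-hand side is about \<open>8.24\<close>, the right-hand side \<open>8\<close>.\<close>

lemma exp_mult_le:
  fixes w m :: nat
  assumes "0 < w" "w < m" "\<not> (w = 2 \<and> m = 3)"
  shows "exp (1 - 1 / real w) * (real w + real m) \<le> (real m + 1) * real w"
proof -
  consider "w = 1" | "w = 2" "m \<ge> 4" | "w \<ge> 3" "m \<ge> 4"
    using assms by linarith
  then show ?thesis
  proof cases
    case 2
    have "exp (1 / 2 :: real) ^ 2 = exp 1"
      by (simp flip: exp_of_nat_mult)
    \<comment> \<open>The square of 1.65 is 2.7225, just above 2.72, while
      \<open>1.65 * (2 + m) \<le> 2 * (m + 1)\<close> holds from \<open>m = 4\<close> on.\<close>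
    then have "exp (1 / 2 :: real) ^ 2 \<le> (165 / 100) ^ 2"
      using exp_1_less by (simp add: power2_eq_square)
    then have "exp (1 / 2 :: real) \<le> 165 / 100"
      by (rule power2_le_imp_le) simp
    then have "exp (1 / 2) * (2 + real m) \<le> 165 / 100 * (2 + real m)"
      by (intro mult_right_mono) auto
    also have "\<dots> \<le> (real m + 1) * 2"
      using 2 by (simp add: field_simps)
    finally show ?thesis using 2 by simp
  next
    case 3
    have w: "real w > 0" using 3 by simp
    have "exp (1 - 1 / real w) = exp 1 / exp (1 / real w)"
      by (simp add: exp_diff)
    also have "\<dots> \<le> (272 / 100) / (1 + 1 / real w)"
      using w exp_1_less by (intro frac_le exp_ge_add_one_self) (auto intro: add_pos_pos)
    also have "\<dots> = (272 / 100) * real w / (real w + 1)"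
      using w by (simp add: field_simps)
    finally have "exp (1 - 1 / real w) * (real w + real m)
        \<le> (272 / 100) * real w / (real w + 1) * (real w + real m)"
      by (intro mult_right_mono) auto
    also have "\<dots> = real w * (272 / 100 * (real w + real m)) / (real w + 1)"
      by simp
    also have "\<dots> \<le> real w * ((real w + 1) * (real m + 1)) / (real w + 1)"
    proof -
      \<comment> \<open>This product bounds \<open>w * m\<close> below by
        \<open>4 * w + 3 * m - 12\<close>, leaving a linear inequality that holds for
        \<open>w \<ge> 3\<close> and \<open>m \<ge> 4\<close>.\<close>
      have "(real w - 3) * (real m - 4) \<ge> 0"
        using 3 by simp
      then have "272 / 100 * (real w + real m) \<le> (real w + 1) * (real m + 1)"
        using 3 by (simp add: algebra_simps)
      then show ?thesis
        using w by (intro divide_right_mono mult_left_mono) auto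
    qed
    also have "\<dots> = (real m + 1) * real w"
      using w by (simp add: field_simps)
    finally show ?thesis .
  qed simp
qed

text \<open>From \<open>(1 + w/m) ^ m \<le> exp w\<close>, one factor \<open>exp 1\<close> is set
  aside and the remaining \<open>exp (w - 1)\<close> is spread evenly over the \<open>w\<close>
  factors \<open>w + m\<close>; each of these is then bounded by \<open>exp_mult_le\<close>.\<close>

lemma self_power_le:
  fixes w m :: nat
  assumes "0 < w" "w < m"
  shows "real (w + m) ^ (w + m) \<le> exp 1 * (real m + 1) ^ w * (real w ^ w * real m ^ m)"
proof (cases "w = 2 \<and> m = 3")
  case True
  \<comment> \<open>In the exceptional case the claim is \<open>3125 \<le> 1728 * exp 1\<close>, for
    which \<open>exp 1 \<ge> 2\<close> suffices.\<close>
  have "2 \<le> exp (1 :: real)"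
    using exp_ge_add_one_self[of 1] by simp
  with True show ?thesis by simp
next
  case False
  have "(real w + real m) ^ m = (1 + real w / real m) ^ m * real m ^ m"
    using assms by (simp add: field_simps flip: power_mult_distrib)
  also have "\<dots> \<le> exp (real w) * real m ^ m"
    using assms exp_ge_one_plus_x_over_n_power_n[of m "real w"] by (intro mult_right_mono) auto
  also have "exp (real w) = exp 1 * exp (1 - 1 / real w) ^ w"
    using assms by (simp add: field_simps flip: exp_of_nat_mult exp_add)
  finally have "(real w + real m) ^ m * (real w + real m) ^ w
      \<le> exp 1 * exp (1 - 1 / real w) ^ w * real m ^ m * (real w + real m) ^ w"
    by (intro mult_right_mono) auto
  also have "\<dots> = exp 1 * real m ^ m * (exp (1 - 1 / real w) * (real w + real m)) ^ w"
    by (simp add: power_mult_distrib)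
  also have "\<dots> \<le> exp 1 * real m ^ m * ((real m + 1) * real w) ^ w"
    using exp_mult_le[OF assms False] by (intro mult_left_mono power_mono) auto
  finally show ?thesis
    by (simp add: power_mult_distrib power_add mult_ac)
qed

theorem theorem3p5:
  fixes C :: "(bit ^ 'n) set" and w :: nat
  assumes "vec.subspace C"
    and "weakly_self_dual C"
    and "0 < w" and "real w < real CARD('n) / 2"
  shows "real (weight_distribution C w)
           \<le> 2 powr (1 / 2 * binary_entropy (real w / real CARD('n)) * real CARD('n))
       \<and> real (weight_distribution C w)
           \<le> sqrt (exp 1) * (real CARD('n) - real w + 1) powr (real w / 2)"
proof -
  define A where "A = real (weight_distribution C w)"
  define m where "m = CARD('n) - w"
  define h where "h = binary_entropy (real w / real CARD('n)) * real CARD('n)"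
  have n: "CARD('n) = w + m" and m: "w < m" "0 < m"
    using assms(4) by (auto simp: m_def)
  \<comment> \<open>The choice \<open>z = w/m\<close> minimizes \<open>(1 + z) ^ n / z ^ w\<close>
    over positive \<open>z\<close>.\<close>
  have "A\<^sup>2 * (real w / real m) ^ w \<le> (1 + real w / real m) ^ CARD('n)"
    unfolding A_def using assms by (intro weight_distribution_le) auto
  also have "1 + real w / real m = real (w + m) / real m"
    using m by (simp add: field_simps)
  finally have "A\<^sup>2 \<le> real (w + m) ^ (w + m) / (real w ^ w * real m ^ m)"
    using m assms(3) by (simp add: n power_divide power_add field_simps)
  also have "\<dots> = 2 powr h"
    unfolding h_def n by (rule powr_binary_entropy[symmetric]) (use m assms in auto)
  finally have A: "A\<^sup>2 \<le> 2 powr h" .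
  have "A \<le> sqrt (2 powr h)"
    using A by (rule real_le_rsqrt)
  also have sqrt_h: "sqrt (2 powr h) = 2 powr (1 / 2 * h)"
    by (simp add: powr_powr flip: powr_half_sqrt)
  finally have first: "A \<le> 2 powr (1 / 2 * h)" .
  \<comment> \<open>The second bound weakens the first at the level of squares, so the roots are
    taken only afterwards.\<close>
  have "2 powr h \<le> exp 1 * (real m + 1) ^ w"
    unfolding h_def powr_binary_entropy[OF assms(3) m(2) n]
    using self_power_le[OF assms(3) m(1)] m assms(3) by (simp add: n field_simps)
  with A have "A \<le> sqrt (exp 1 * (real m + 1) ^ w)"
    by (intro real_le_rsqrt) linarith
  also have "\<dots> = sqrt (exp 1) * (real m + 1) powr (real w / 2)"
    by (simp add: real_sqrt_mult powr_powr flip: powr_half_sqrt powr_realpow)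
  also have "real m = real CARD('n) - real w"
    by (simp add: n)
  finally show ?thesis
    using first by (simp add: A_def h_def mult.assoc)
qed

end
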